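(* Let $X$ be an order complete locally solid $f$-ring. Then the following are equivalent. (i) $X$ possesses the $AM$-property and the Levi property. (ii) Every order bounded subset of $X$ is bounded, and every bounded subset of $X$ is order bounded.
   Context: An $\ell$-ring (lattice ring) is a ring which is also a lattice, the additive group being a lattice-ordered group, with $|x\cdot y|\le |x|\cdot|y|$ for all $x,y$. $X_+=\{x\in X: x\ge 0\}$. A set $S\subseteq X$ is solid if $x\in X$, $y\in S$, $|x|\le|y|$ imply $x\in S$. A locally solid $\ell$-ring is an $\ell$-ring that is also a topological ring and has a local basis at zero consisting of solid sets. An $f$-ring is an $\ell$-ring in which $a\wedge b=0$ and $c>0$ imply $ca\wedge b=ac\wedge b=0$; a locally solid $f$-ring is a locally solid $\ell$-ring that is an $f$-ring. Order complete: every non-empty subset that is bounded above has a supremum. Archimedean: $nx\le y$ for all $n\in\mathbb N$ implies $x\le 0$. A set $B\subseteq X$ in a topological ring is bounded if for each zero neighborhood $W$ there is a zero neighborhood $V$ with $VB\subseteq W$ and $BV\subseteq W$ (sets of products). A set is order bounded if it is contained in some order interval $[u,v]=\{x: u\le x\le v\}$. For $B\subseteq X$, $B^{\vee}=\{b_1\vee\dots\vee b_n: n\in\mathbb N,\ b_i\in B\}$. An Archimedean locally solid $\ell$-ring $X$ has the $AM$-property if $B^{\vee}$ is bounded for every bounded $B\subseteq X$. A locally solid $\ell$-ring $X$ has the Levi property if every bounded upward directed set in $X_+$ has a supremum. Standing assumption: in every topological group considered (including the additive groups of topological rings), singletons are bounded in the group sense: for each $x$ and each neighborhood $U$ of the identity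 there is a positive integer $n$ with $x\in nU=\{x_1+\dots+x_n: x_i\in U\}$. *)

theory Defs
  imports "HOL-Analysis.Analysis" "HOL-Library.Lattice_Algebras" "HOL-Library.Lub_Glb"
begin

text \<open>
  Lattice rings are the library class \<^class>\<open>lattice_ring\<close> (associative, not necessarily unital or
  commutative). Its axioms require multiplication by nonnegative elements to be monotone instead of
  the inequality \<open>\<bar>x * y\<bar> \<le> \<bar>x\<bar> * \<bar>y\<bar>\<close>. The two are equivalent: one direction is the library fact
  \<open>abs_le_mult\<close>, the other one is the following lemma.
\<close>

lemma mult_mono_if_abs_mult_le:
  fixes a b c :: "'a :: {ring, lattice_ab_group_add_abs}"
  assumes abs_mult: "\<And>x y :: 'a. \<bar>x * y\<bar> \<le> \<bar>x\<bar> * \<bar>y\<bar>"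
    and "a \<le> b" "0 \<le> c"
  shows "c * a \<le> c * b" "a * c \<le> b * c"
proof -
  have nonneg: "0 \<le> x * y" if "0 \<le> x" "0 \<le> y" for x y :: 'a
  proof -
    have "0 \<le> \<bar>x * y\<bar>" by simp
    also have "\<dots> \<le> \<bar>x\<bar> * \<bar>y\<bar>" by (rule abs_mult)
    finally show ?thesis using that by simp
  qed
  from nonneg[of c "b - a"] nonneg[of "b - a" c] assms(2,3)
  show "c * a \<le> c * b" "a * c \<le> b * c"
    by (simp_all add: algebra_simps)
qed

class f_ring = lattice_ring +
  assumes f_ring_left: "inf a b = 0 \<Longrightarrow> 0 < c \<Longrightarrow> inf (c * a) b = 0"
    and f_ring_right: "inf a b = 0 \<Longrightarrow> 0 < c \<Longrightarrow> inf (a * c) b = 0"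

definition (in lattice_ab_group_add_abs) solid :: "'a set \<Rightarrow> bool"
  where "solid S \<longleftrightarrow> (\<forall>x. \<forall>y\<in>S. \<bar>x\<bar> \<le> \<bar>y\<bar> \<longrightarrow> x \<in> S)"

definition zero_neighborhood :: "'a::{topological_space, zero} set \<Rightarrow> bool"
  where "zero_neighborhood W \<longleftrightarrow> (\<exists>U. open U \<and> 0 \<in> U \<and> U \<subseteq> W)"

text \<open>
  The topology is not assumed to be Hausdorff. The class axiom says that the solid neighborhoods of
  zero form a local basis at zero. A basic neighborhood \<open>V\<close> need not be open.
\<close>

class locally_solid_l_ring =
  lattice_ring + topological_ab_group_add + topological_semigroup_mult +
  assumes locally_solid:
    "open W \<Longrightarrow> 0 \<in> W \<Longrightarrow> \<exists>V U. solid V \<and> V \<subseteq> W \<and> open U \<and> 0 \<in> U \<and> U \<subseteq> V"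

class locally_solid_f_ring = locally_solid_l_ring + f_ring

definition order_complete :: "'a::order itself \<Rightarrow> bool"
  where "order_complete _ \<longleftrightarrow> (\<forall>S::'a set. S \<noteq> {} \<and> bdd_above S \<longrightarrow> (\<exists>s. isLub UNIV S s))"

definition archimedean :: "'a::{comm_monoid_add, ord} itself \<Rightarrow> bool"
  where "archimedean _ \<longleftrightarrow> (\<forall>x y::'a. (\<forall>n\<ge>1. (\<Sum>i<n::nat. x) \<le> y) \<longrightarrow> x \<le> 0)"

definition ring_bounded :: "'a::{topological_space, ring} set \<Rightarrow> bool"
  where "ring_bounded B \<longleftrightarrow>
    (\<forall>W. zero_neighborhood W \<longrightarrow>
      (\<exists>V. zero_neighborhood V \<and> (\<forall>v\<in>V. \<forall>b\<in>B. v * b \<in> W \<and> b * v \<in> W)))"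

definition order_bounded :: "'a::order set \<Rightarrow> bool"
  where "order_bounded B \<longleftrightarrow> (\<exists>u v. B \<subseteq> {u..v})"

definition finite_sups :: "'a::lattice set \<Rightarrow> 'a set"
  where "finite_sups B = {Sup_fin F | F. finite F \<and> F \<noteq> {} \<and> F \<subseteq> B}"

definition upward_directed :: "'a::order set \<Rightarrow> bool"
  where "upward_directed D \<longleftrightarrow> D \<noteq> {} \<and> (\<forall>x\<in>D. \<forall>y\<in>D. \<exists>z\<in>D. x \<le> z \<and> y \<le> z)"

definition AM_property :: "'a::locally_solid_l_ring itself \<Rightarrow> bool"
  where "AM_property _ \<longleftrightarrow>
    archimedean TYPE('a) \<and> (\<forall>B::'a set. ring_bounded B \<longrightarrow> ring_bounded (finite_sups B))"

definition Levi_property :: "'a::locally_solid_l_ring itself \<Rightarrow> bool"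
  where "Levi_property _ \<longleftrightarrow>
    (\<forall>D::'a set. ring_bounded D \<and> upward_directed D \<and> D \<subseteq> {0..} \<longrightarrow> (\<exists>s. isLub UNIV D s))"

text \<open>
  Boundedness of singletons in the sense of topological groups, which is different from
  \<^const>\<open>ring_bounded\<close>: every \<open>x\<close> lies in some \<open>n\<close>-fold sum \<open>U + \<dots> + U\<close> with \<open>n > 0\<close>.
\<close>

definition singletons_group_bounded :: "'a::{topological_space, comm_monoid_add} itself \<Rightarrow> bool"
  where "singletons_group_bounded _ \<longleftrightarrow>
    (\<forall>(x::'a) U. zero_neighborhood U \<longrightarrow>
      (\<exists>(n::nat) f. n > 0 \<and> (\<forall>i<n. f i \<in> U) \<and> x = (\<Sum>i<n. f i)))"

end

theory Submission
  imports Defs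
begin

text \<open>
  The two notions of boundedness are linked by two facts.

  Order bounded sets are always bounded (\<open>order_bounded_imp_ring_bounded\<close>). Multiplication by a
  fixed \<open>w \<ge> 0\<close> is continuous at zero, so some solid \<open>V\<close> satisfies \<open>V w \<subseteq> W\<close> and \<open>w V \<subseteq> W\<close>; since
  \<open>\<bar>v * b\<bar> \<le> \<bar>v\<bar> * w\<close> whenever \<open>\<bar>b\<bar> \<le> w\<close>, solidity of \<open>V\<close> and \<open>W\<close> makes the same \<open>V\<close> work
  for all of \<open>[-w, w]\<close> at once.

  Under the AM and Levi properties, bounded sets are order bounded
  (\<open>AM_Levi_imp_order_bounded\<close>). The finite suprema of \<open>B \<union> -B\<close> form a bounded set that is
  closed under binary suprema and contains \<open>\<bar>b\<bar> = sup b (- b)\<close> for each \<open>b \<in> B\<close>. Its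
  nonnegative members are therefore a bounded upward directed set, and their supremum bounds
  \<open>\<bar>b\<bar>\<close> for all \<open>b \<in> B\<close>.

  Conversely, if bounded and order bounded sets coincide, then the AM property only asks for
  finite suprema to stay in an order interval, and the Levi property is a case of order
  completeness, which also yields the Archimedean property.
\<close>

section \<open>Solid neighborhoods of zero\<close>

lemma solid_zero_neighborhood:
  fixes W :: "'a::locally_solid_l_ring set"
  assumes "zero_neighborhood W"
  obtains V where "solid V" "zero_neighborhood V" "V \<subseteq> W"
proof -
  from assms obtain O' where O': "open O'" "0 \<in> O'" "O' \<subseteq> W"
    unfolding zero_neighborhood_def by blast
  obtain V U where "solid V" "V \<subseteq> O'" "open U" "0 \<in> U" "U \<subseteq> V"
    using locally_solid[OF O'(1,2)] by blast
  with O'(3) show ?thesis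
    by (intro that[of V]) (auto simp: zero_neighborhood_def)
qed

lemma solidD: "solid S \<Longrightarrow> y \<in> S \<Longrightarrow> \<bar>x\<bar> \<le> \<bar>y\<bar> \<Longrightarrow> x \<in> S"
  unfolding solid_def by blast

lemma zero_neighborhood_mult_left_right:
  fixes w :: "'a::locally_solid_l_ring"
  assumes "zero_neighborhood W"
  shows "zero_neighborhood {v. v * w \<in> W \<and> w * v \<in> W}"
proof -
  from assms obtain U where U: "open U" "0 \<in> U" "U \<subseteq> W"
    unfolding zero_neighborhood_def by blast
  have left: "open ((\<lambda>v. v * w) -` U)" and right: "open ((\<lambda>v. w * v) -` U)"
    using U(1) by (auto intro!: open_vimage tendsto_mult tendsto_ident_at simp: continuous_on_def)
  show ?thesis
    unfolding zero_neighborhood_def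
    using open_Int[OF left right] U(2,3)
    by (intro exI[of _ "(\<lambda>v. v * w) -` U \<inter> (\<lambda>v. w * v) -` U"]) auto
qed

section \<open>Bounded sets\<close>

lemma ring_bounded_subset: "ring_bounded B \<Longrightarrow> A \<subseteq> B \<Longrightarrow> ring_bounded A"
  unfolding ring_bounded_def by blast

text \<open>
  Taking the neighborhood \<open>V\<close> solid makes it closed under negation, so that
  \<open>v * (- b) = (- v) * b\<close> reduces the products with \<open>- b\<close> to those with \<open>b\<close>.
\<close>

lemma ring_bounded_Un_uminus:
  fixes B :: "'a::locally_solid_l_ring set"
  assumes "ring_bounded B"
  shows "ring_bounded (B \<union> uminus ` B)"
  unfolding ring_bounded_def
proof (intro allI impI)
  fix W :: "'a set"
  assume "zero_neighborhood W"
  then obtain V where V: "zero_neighborhood V" "\<forall>v\<in>V. \<forall>b\<in>B. v * b \<in> W \<and> b * v \<in> W"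
    using assms unfolding ring_bounded_def by blast
  obtain V' where V': "solid V'" "zero_neighborhood V'" "V' \<subseteq> V"
    using solid_zero_neighborhood[OF V(1)] .
  have "v * b \<in> W \<and> b * v \<in> W" if v: "v \<in> V'" and b: "b \<in> B \<union> uminus ` B" for v b
  proof (cases "b \<in> B")
    case True
    then show ?thesis using v V(2) V'(3) by blast
  next
    case False
    with b obtain c where c: "c \<in> B" "b = - c" by blast
    have "- v \<in> V'" using solidD[OF V'(1) v, of "- v"] by simp
    then have "(- v) * c \<in> W \<and> c * (- v) \<in> W" using c V(2) V'(3) by blast
    then show ?thesis using c by simp
  qed
  with V'(2) show "\<exists>V. zero_neighborhood V \<and>
      (\<forall>v\<in>V. \<forall>b\<in>B \<union> uminus ` B. v * b \<in> W \<and> b * v \<in> W)"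
    by blast
qed

lemma abs_mult_le_mult:
  fixes a b c d :: "'a::lattice_ring"
  assumes "\<bar>a\<bar> \<le> c" "\<bar>b\<bar> \<le> d"
  shows "\<bar>a * b\<bar> \<le> c * d"
proof -
  have "0 \<le> c" using order_trans[OF abs_ge_zero assms(1)] .
  have "\<bar>a * b\<bar> \<le> \<bar>a\<bar> * \<bar>b\<bar>" by (rule abs_le_mult)
  also have "\<dots> \<le> c * \<bar>b\<bar>" using assms(1) by (rule mult_right_mono) simp
  also have "\<dots> \<le> c * d" using assms(2) \<open>0 \<le> c\<close> by (rule mult_left_mono)
  finally show ?thesis .
qed

text \<open>
  For \<open>\<bar>b\<bar> \<le> w\<close>, the products of \<open>b\<close> with \<open>v\<close> are dominated by those of \<open>w\<close> with \<open>\<bar>v\<bar>\<close>, so a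
  solid neighborhood that serves the single element \<open>w\<close> serves all such \<open>b\<close>.
\<close>

lemma order_bounded_imp_ring_bounded:
  fixes B :: "'a::locally_solid_l_ring set"
  assumes "order_bounded B"
  shows "ring_bounded B"
  unfolding ring_bounded_def
proof (intro allI impI)
  fix W :: "'a set"
  assume "zero_neighborhood W"
  then obtain W' where W': "solid W'" "zero_neighborhood W'" "W' \<subseteq> W"
    using solid_zero_neighborhood by metis
  from assms obtain p q where pq: "B \<subseteq> {p..q}"
    unfolding order_bounded_def by blast
  define w where "w = \<bar>p\<bar> + \<bar>q\<bar>"
  have abs_le_w: "\<bar>b\<bar> \<le> w" if "b \<in> B" for b
  proof (rule abs_leI)
    from that pq have b: "p \<le> b" "b \<le> q" by auto
    have "b \<le> \<bar>q\<bar>" using b(2) abs_ge_self by (rule order_trans)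
    also have "\<dots> \<le> w" unfolding w_def by simp
    finally show "b \<le> w" .
    have "- b \<le> - p" using b(1) by simp
    also have "\<dots> \<le> \<bar>p\<bar>" by (rule abs_ge_minus_self)
    also have "\<dots> \<le> w" unfolding w_def by simp
    finally show "- b \<le> w" .
  qed
  obtain V where V: "solid V" "zero_neighborhood V" "V \<subseteq> {v. v * w \<in> W' \<and> w * v \<in> W'}"
    using solid_zero_neighborhood[OF zero_neighborhood_mult_left_right[OF W'(2)]] .
  have "v * b \<in> W \<and> b * v \<in> W" if v: "v \<in> V" and b: "b \<in> B" for v b
  proof -
    have "\<bar>v\<bar> \<in> V" using solidD[OF V(1) v, of "\<bar>v\<bar>"] by simp
    then have mem: "\<bar>v\<bar> * w \<in> W'" "w * \<bar>v\<bar> \<in> W'" using V(3) by auto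
    have "\<bar>v * b\<bar> \<le> \<bar>\<bar>v\<bar> * w\<bar>" "\<bar>b * v\<bar> \<le> \<bar>w * \<bar>v\<bar>\<bar>"
      using abs_mult_le_mult[OF order_refl abs_le_w[OF b]]
        abs_mult_le_mult[OF abs_le_w[OF b] order_refl] abs_ge_self
      by (blast intro: order_trans)+
    with mem show ?thesis using solidD[OF W'(1)] W'(3) by blast
  qed
  with V(2) show "\<exists>V. zero_neighborhood V \<and> (\<forall>v\<in>V. \<forall>b\<in>B. v * b \<in> W \<and> b * v \<in> W)"
    by blast
qed

section \<open>Finite suprema and the AM and Levi properties\<close>

lemma sup_mem_finite_sups:
  fixes x y :: "'a::lattice"
  assumes "x \<in> finite_sups B" "y \<in> finite_sups B"
  shows "sup x y \<in> finite_sups B"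
proof -
  from assms obtain F G where "finite F" "F \<noteq> {}" "F \<subseteq> B" "x = Sup_fin F"
    "finite G" "G \<noteq> {}" "G \<subseteq> B" "y = Sup_fin G"
    unfolding finite_sups_def by blast
  moreover from this have "Sup_fin (F \<union> G) = sup x y" by (simp add: Sup_fin.union)
  ultimately show ?thesis
    unfolding finite_sups_def by (auto intro!: exI[of _ "F \<union> G"])
qed

lemma subset_finite_sups: "B \<subseteq> finite_sups B" for B :: "'a::lattice set"
proof
  fix b assume "b \<in> B"
  then show "b \<in> finite_sups B"
    unfolding finite_sups_def by (auto intro!: exI[of _ "{b}"])
qed

lemma finite_sups_subset_atLeastAtMost:
  fixes B :: "'a::lattice set"
  assumes "B \<subseteq> {u..v}"
  shows "finite_sups B \<subseteq> {u..v}"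
proof
  fix x assume "x \<in> finite_sups B"
  then obtain F where F: "finite F" "F \<noteq> {}" "F \<subseteq> B" "x = Sup_fin F"
    unfolding finite_sups_def by blast
  then obtain b where b: "b \<in> F" by blast
  have "u \<le> b" using b F(3) assms by auto
  also have "b \<le> x" using F b by (auto intro: Sup_fin.coboundedI)
  finally have "u \<le> x" .
  moreover have "x \<le> v" using F assms by (auto intro!: Sup_fin.boundedI)
  ultimately show "x \<in> {u..v}" by simp
qed

text \<open>
  The Levi property concerns sets of nonnegative elements only. Passing to \<open>B \<union> -B\<close> puts the
  absolute values of the elements of \<open>B\<close> among the finite suprema, so discarding the other finite
  suprema loses nothing.
\<close>

lemma AM_Levi_imp_order_bounded:
  fixes B :: "'a::locally_solid_l_ring set"
  assumes AM: "AM_property TYPE('a)" and Levi: "Levi_property TYPE('a)"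
    and B: "ring_bounded B"
  shows "order_bounded B"
proof (cases "B = {}")
  case True
  then show ?thesis by (simp add: order_bounded_def)
next
  case False
  define C where "C = B \<union> uminus ` B"
  define D where "D = finite_sups C \<inter> {0..}"
  have abs_in_D: "\<bar>b\<bar> \<in> D" if "b \<in> B" for b
  proof -
    have "b \<in> finite_sups C" "- b \<in> finite_sups C"
      using that subset_finite_sups[of C] unfolding C_def by auto
    then have "sup b (- b) \<in> finite_sups C" by (rule sup_mem_finite_sups)
    then show ?thesis unfolding D_def by (simp flip: abs_lattice)
  qed
  have "ring_bounded (finite_sups C)"
    using AM ring_bounded_Un_uminus[OF B] unfolding AM_property_def C_def by blast
  then have "ring_bounded D" by (rule ring_bounded_subset) (simp add: D_def)
  moreover have "upward_directed D"
    unfolding upward_directed_def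
  proof (intro conjI ballI)
    show "D \<noteq> {}" using False abs_in_D by blast
    fix x y assume "x \<in> D" "y \<in> D"
    then have "sup x y \<in> D"
      unfolding D_def by (auto intro: sup_mem_finite_sups le_supI1)
    then show "\<exists>z\<in>D. x \<le> z \<and> y \<le> z" by (intro bexI[of _ "sup x y"]) auto
  qed
  moreover have "D \<subseteq> {0..}" by (simp add: D_def)
  ultimately obtain s where s: "isLub UNIV D s"
    using Levi unfolding Levi_property_def by blast
  have "B \<subseteq> {- s..s}"
  proof
    fix b assume "b \<in> B"
    then have "\<bar>b\<bar> \<le> s" using isLubD2[OF s] abs_in_D by blast
    then have "b \<le> s" "- b \<le> s" by (simp_all add: abs_le_iff)
    then show "b \<in> {- s..s}" by (simp add: minus_le_iff)
  qed
  then show ?thesis unfolding order_bounded_def by blast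
qed

section \<open>Order completeness\<close>

text \<open>
  If \<open>s\<close> is the supremum of the multiples \<open>n x\<close> with \<open>n \<ge> 1\<close>, then \<open>(n + 1) x \<le> s\<close> shows that
  \<open>s - x\<close> is again an upper bound of them, so \<open>s \<le> s - x\<close>.
\<close>

lemma order_complete_imp_archimedean:
  assumes "order_complete TYPE('a::lattice_ab_group_add)"
  shows "archimedean TYPE('a)"
  unfolding archimedean_def
proof (intro allI impI)
  fix x y :: 'a
  assume bound: "\<forall>n\<ge>1. (\<Sum>i<n::nat. x) \<le> y"
  define S where "S = (\<lambda>n::nat. \<Sum>i<n. x) ` {1..}"
  have "S \<noteq> {}" unfolding S_def by auto
  moreover have "bdd_above S" using bound unfolding S_def bdd_above_def by auto
  ultimately obtain s where s: "isLub UNIV S s"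
    using assms unfolding order_complete_def by blast
  have "isUb UNIV S (s - x)"
  proof (rule isUb_UNIV_I)
    fix z assume "z \<in> S"
    then obtain n :: nat where n: "n \<ge> 1" "z = (\<Sum>i<n. x)" unfolding S_def by auto
    have "(\<Sum>i<Suc n. x) \<in> S" unfolding S_def by (rule imageI) simp
    then have "(\<Sum>i<Suc n. x) \<le> s" by (rule isLubD2[OF s])
    then show "z \<le> s - x" using n(2) by (simp add: le_diff_eq)
  qed
  then have "s \<le> s - x" by (rule isLub_le_isUb[OF s])
  then show "x \<le> 0" by (simp add: le_diff_eq)
qed

lemma bounded_iff_order_bounded_imp_AM:
  assumes "archimedean TYPE('a::locally_solid_l_ring)"
    and "\<And>B :: 'a set. ring_bounded B \<longleftrightarrow> order_bounded B"
  shows "AM_property TYPE('a)"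
  using assms finite_sups_subset_atLeastAtMost
  unfolding AM_property_def order_bounded_def by metis

lemma bounded_imp_order_bounded_imp_Levi:
  assumes "order_complete TYPE('a::locally_solid_l_ring)"
    and "\<And>B :: 'a set. ring_bounded B \<Longrightarrow> order_bounded B"
  shows "Levi_property TYPE('a)"
  unfolding Levi_property_def
proof (intro allI impI)
  fix D :: "'a set"
  assume D: "ring_bounded D \<and> upward_directed D \<and> D \<subseteq> {0..}"
  then obtain u v where "D \<subseteq> {u..v}"
    using assms(2) unfolding order_bounded_def by blast
  then have "bdd_above D" by (rule bdd_above_mono[OF bdd_above_Icc])
  moreover have "D \<noteq> {}" using D unfolding upward_directed_def by blast
  ultimately show "\<exists>s. isLub UNIV D s"
    using assms(1) unfolding order_complete_def by blast
qed

theorem theorem2: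
  assumes "singletons_group_bounded TYPE('a::locally_solid_f_ring)"
    and "order_complete TYPE('a)"
  shows "(AM_property TYPE('a) \<and> Levi_property TYPE('a)) \<longleftrightarrow>
    ((\<forall>B::'a set. order_bounded B \<longrightarrow> ring_bounded B) \<and>
     (\<forall>B::'a set. ring_bounded B \<longrightarrow> order_bounded B))"
proof
  assume "AM_property TYPE('a) \<and> Levi_property TYPE('a)"
  then show "(\<forall>B::'a set. order_bounded B \<longrightarrow> ring_bounded B) \<and>
      (\<forall>B::'a set. ring_bounded B \<longrightarrow> order_bounded B)"
    using order_bounded_imp_ring_bounded AM_Levi_imp_order_bounded by blast
next
  assume "(\<forall>B::'a set. order_bounded B \<longrightarrow> ring_bounded B) \<and>
      (\<forall>B::'a set. ring_bounded B \<longrightarrow> order_bounded B)"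
  then have iff: "ring_bounded B \<longleftrightarrow> order_bounded B" for B :: "'a set" by blast
  show "AM_property TYPE('a) \<and> Levi_property TYPE('a)"
    using bounded_iff_order_bounded_imp_AM[OF order_complete_imp_archimedean[OF assms(2)] iff]
      bounded_imp_order_bounded_imp_Levi[OF assms(2)] iff
    by blast
qed

end
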